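(* If $|A|\ge 3$, then the Borda social choice correspondence $BO$ is $\Omega^{BO}$-$\mathbf{K}$-manipulable.
   Context: Standing setting: $A$ (alternatives) and $I$ (individuals) are finite sets with $|A|\ge 2$, $|I|\ge 2$. $P_0(X)$ is the set of nonempty subsets of $X$. For a relation $R$ on a set $X$, $x\succeq_R y$ means $(x,y)\in R$, and $x\succ_R y$ means $(x,y)\in R$ and $(y,x)\notin R$. $\mathcal{L}(A)$ is the set of linear orders (complete, transitive, antisymmetric relations) on $A$; for $q\in\mathcal{L}(A)$, $\mathrm{rank}_q(x)=|\{y\in A: y\succeq_q x\}|$ (so rank $1$ is best). For $J\subseteq I$, $\mathcal{L}(A)^J$ is the set of functions $J\to\mathcal{L}(A)$. For $i\in I$, $\overline{p}\in\mathcal{L}(A)^{I\setminus\{i\}}$, $q\in\mathcal{L}(A)$, $(\overline{p},q[i])\in\mathcal{L}(A)^I$ is the profile equal to $q$ at $i$ and to $\overline{p}(j)$ at every $j\ne i$. A social choice correspondence (scc) is a function $F:\mathcal{L}(A)^I\to P_0(A)$. Borda: for $p\in\mathcal{L}(A)^I$, $BO(p)=\mathrm{argmax}_{x\in A}\sum_{i\in I}\big(|A|-\mathrm{rank}_{p(i)}(x)\big)$ (set of all maximizers). Kelly extension rule: for $q\in\mathcal{L}(A)$, $\mathbf{K}(q)$ is the relation on $P_0(A)$ given by $(B,C)\in\mathbf{K}(q)$ iff $B=C$ or $x\succeq_q y$ for all $x\in B$, $y\in C$. Winner information: for a scc $F$, $i\in I$, $q\in\mathcal{L}(A)$, $\Omega^F_i(q)=\big\{\{\overline{p}\in\mathcal{L}(A)^{I\setminus\{i\}}:F(\overline{p},q[i])=X\}: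 X\in\mathrm{Im}(F)\big\}\setminus\{\varnothing\}$. A scc $F$ is $\Omega^F$-$\mathbf{K}$-manipulable if there exist $i\in I$, $q,q'\in\mathcal{L}(A)$ and $\omega\in\Omega^F_i(q)$ such that $F(\overline{p}',q'[i])\succ_{\mathbf{K}(q)}F(\overline{p}',q[i])$ for some $\overline{p}'\in\omega$, and $F(\overline{p},q'[i])\succeq_{\mathbf{K}(q)}F(\overline{p},q[i])$ for every $\overline{p}\in\omega$. *)

theory Defs
  imports "HOL-Library.FuncSet"
begin

definition nonempty_subsets :: "'a set \<Rightarrow> 'a set set" where
  "nonempty_subsets X = Pow X - {{}}"

text \<open>Preference relations list the better alternative first: \<open>(x, y) \<in> R\<close> says that
  \<open>x\<close> is weakly preferred to \<open>y\<close>.\<close>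

definition weakly_prefers :: "('x \<times> 'x) set \<Rightarrow> 'x \<Rightarrow> 'x \<Rightarrow> bool" where
  "weakly_prefers R x y \<longleftrightarrow> (x, y) \<in> R"

definition strictly_prefers :: "('x \<times> 'x) set \<Rightarrow> 'x \<Rightarrow> 'x \<Rightarrow> bool" where
  "strictly_prefers R x y \<longleftrightarrow> (x, y) \<in> R \<and> (y, x) \<notin> R"

text \<open>Completeness includes the case of equal arguments, so complete, transitive and antisymmetric
  relations on \<open>A\<close> are exactly the (reflexive) linear orders of the library.\<close>

definition linear_orders :: "'a set \<Rightarrow> ('a \<times> 'a) set set" where
  "linear_orders A = {q. linear_order_on A q}"

lemma linear_orders_iff:
  "q \<in> linear_orders A \<longleftrightarrow>
     q \<subseteq> A \<times> A \<and> (\<forall>x\<in>A. \<forall>y\<in>A. (x, y) \<in> q \<or> (y, x) \<in> q) \<and> trans q \<and> antisym q"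
proof
  assume "q \<in> linear_orders A"
  then have "q \<subseteq> A \<times> A" "refl_on A q" "trans q" "antisym q" "total_on A q"
    by (simp_all add: linear_orders_def order_on_defs)
  then show "q \<subseteq> A \<times> A \<and> (\<forall>x\<in>A. \<forall>y\<in>A. (x, y) \<in> q \<or> (y, x) \<in> q) \<and> trans q \<and> antisym q"
    by (metis refl_onD total_on_def)
next
  assume *: "q \<subseteq> A \<times> A \<and> (\<forall>x\<in>A. \<forall>y\<in>A. (x, y) \<in> q \<or> (y, x) \<in> q) \<and> trans q \<and> antisym q"
  then have "refl_on A q" "total_on A q"
    by (auto simp: refl_on_def total_on_def)
  with * show "q \<in> linear_orders A"
    by (simp add: linear_orders_def order_on_defs)
qed

definition rank :: "'a set \<Rightarrow> ('a \<times> 'a) set \<Rightarrow> 'a \<Rightarrow> nat" where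
  "rank A q x = card {y \<in> A. weakly_prefers q y x}"

text \<open>Functions on \<open>J\<close> are represented extensionally (\<open>undefined\<close> outside \<open>J\<close>). Hence, for a
  profile \<open>p\<close> on \<open>I - {i}\<close> with \<open>i \<in> I\<close>, the profile on \<open>I\<close> that extends \<open>p\<close> by \<open>q\<close> at \<open>i\<close>
  is \<open>p(i := q)\<close>.\<close>

definition profiles :: "'a set \<Rightarrow> 'i set \<Rightarrow> ('i \<Rightarrow> ('a \<times> 'a) set) set" where
  "profiles A J = (J \<rightarrow>\<^sub>E linear_orders A)"

lemma profile_extend:
  assumes "i \<in> I" "p \<in> profiles A (I - {i})" "q \<in> linear_orders A"
  shows "p(i := q) \<in> profiles A I"
proof -
  have "p(i := q) \<in> insert i (I - {i}) \<rightarrow>\<^sub>E linear_orders A"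
    using assms unfolding profiles_def by (intro PiE_fun_upd)
  with assms(1) show ?thesis
    by (simp add: profiles_def insert_absorb)
qed

definition scc :: "'a set \<Rightarrow> 'i set \<Rightarrow> (('i \<Rightarrow> ('a \<times> 'a) set) \<Rightarrow> 'a set) \<Rightarrow> bool" where
  "scc A I F \<longleftrightarrow> F \<in> profiles A I \<rightarrow> nonempty_subsets A"

text \<open>The difference is taken in the integers to avoid truncated subtraction.\<close>

definition borda_score ::
    "'a set \<Rightarrow> 'i set \<Rightarrow> ('i \<Rightarrow> ('a \<times> 'a) set) \<Rightarrow> 'a \<Rightarrow> int" where
  "borda_score A I p x = (\<Sum>i\<in>I. int (card A) - int (rank A (p i) x))"

definition borda :: "'a set \<Rightarrow> 'i set \<Rightarrow> ('i \<Rightarrow> ('a \<times> 'a) set) \<Rightarrow> 'a set" where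
  "borda A I p = {x. is_arg_max (borda_score A I p) (\<lambda>x. x \<in> A) x}"

lemma scc_borda:
  assumes "finite A" "A \<noteq> {}"
  shows "scc A I (borda A I)"
proof -
  have "borda A I p \<in> nonempty_subsets A" for p
  proof -
    let ?f = "borda_score A I p"
    have "Max (?f ` A) \<in> ?f ` A"
      using assms by (intro Max_in) auto
    then obtain x where x: "x \<in> A" "?f x = Max (?f ` A)"
      by auto
    have "x \<in> borda A I p"
      using assms x by (auto simp: borda_def is_arg_max_linorder)
    then show ?thesis
      by (auto simp: borda_def nonempty_subsets_def is_arg_max_def)
  qed
  then show ?thesis
    by (simp add: scc_def)
qed

definition kelly :: "'a set \<Rightarrow> ('a \<times> 'a) set \<Rightarrow> ('a set \<times> 'a set) set" where
  "kelly A q = {(B, C). B \<in> nonempty_subsets A \<and> C \<in> nonempty_subsets A \<and>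
     (B = C \<or> (\<forall>x\<in>B. \<forall>y\<in>C. weakly_prefers q x y))}"

definition winner_info ::
    "'a set \<Rightarrow> 'i set \<Rightarrow> (('i \<Rightarrow> ('a \<times> 'a) set) \<Rightarrow> 'a set) \<Rightarrow> 'i \<Rightarrow> ('a \<times> 'a) set
      \<Rightarrow> ('i \<Rightarrow> ('a \<times> 'a) set) set set" where
  "winner_info A I F i q =
     {{p \<in> profiles A (I - {i}). F (p(i := q)) = X} | X. X \<in> F ` profiles A I} - {{}}"

definition manipulable ::
    "'a set \<Rightarrow> 'i set \<Rightarrow> ('i \<Rightarrow> ('a \<times> 'a) set \<Rightarrow> ('i \<Rightarrow> ('a \<times> 'a) set) set set)
      \<Rightarrow> (('a \<times> 'a) set \<Rightarrow> ('a set \<times> 'a set) set)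
      \<Rightarrow> (('i \<Rightarrow> ('a \<times> 'a) set) \<Rightarrow> 'a set) \<Rightarrow> bool" where
  "manipulable A I \<Omega> E F \<longleftrightarrow>
     (\<exists>i\<in>I. \<exists>q\<in>linear_orders A. \<exists>q'\<in>linear_orders A. \<exists>\<omega>\<in>\<Omega> i q.
        (\<exists>p\<in>\<omega>. strictly_prefers (E q) (F (p(i := q'))) (F (p(i := q)))) \<and>
        (\<forall>p\<in>\<omega>. weakly_prefers (E q) (F (p(i := q'))) (F (p(i := q)))))"

end

theory Submission
  imports Defs "HOL-Combinatorics.Transposition"
begin

text \<open>If a voter knows that her worst alternative \<open>z\<close> is the only winner, then no
  misrepresentation can hurt her. So with at least three individuals it is enough to exhibit one
  profile at which \<open>z\<close> beats her second best alternative by a single point and beats all others: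
  exchanging her two best alternatives destroys the victory of \<open>z\<close>. Such a profile of the other
  individuals is built on two or three of them, and the remaining ones are paired off with
  opposite orders, which shifts all scores by the same constant.

  With two individuals the worst alternative is never the only winner. Here the voter, knowing
  that her best two alternatives \<open>a\<close>, \<open>b\<close> are the winners, exchanges \<open>b\<close> with her third
  alternative \<open>c\<close>. Then \<open>a\<close> beats \<open>b\<close>, and \<open>c\<close> cannot catch up with \<open>a\<close>: for this, the other
  individual would have to give \<open>c\<close> the same number of points as \<open>b\<close>.\<close>

subsection \<open>Linear orders given by points\<close>

text \<open>Orders are specified by the points that they award, more points being better. When
  \<open>f\<close> is a bijection onto \<open>{..<card A}\<close>, the value \<open>f x\<close> is
  exactly the Borda contribution of \<open>x\<close>, so scores become sums of such values.\<close>

definition order_of_points :: "'a set \<Rightarrow> ('a \<Rightarrow> nat) \<Rightarrow> ('a \<times> 'a) set" where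
  "order_of_points A f = {(x, y). x \<in> A \<and> y \<in> A \<and> f y \<le> f x}"

lemma order_of_points_linear:
  assumes "inj_on f A"
  shows "order_of_points A f \<in> linear_orders A"
  using assms unfolding linear_orders_iff order_of_points_def
  by (auto simp: trans_def antisym_def inj_on_def)

lemma rank_order_of_points:
  assumes "bij_betw f A {..<m}" "x \<in> A"
  shows "rank A (order_of_points A f) x = m - f x"
proof -
  let ?B = "{y \<in> A. f x \<le> f y}"
  have "f ` ?B = {k \<in> f ` A. f x \<le> k}"
    by auto
  also have "\<dots> = {f x..<m}"
    using assms by (auto simp: bij_betw_def)
  finally have "f ` ?B = {f x..<m}" .
  moreover have "inj_on f ?B"
    using assms by (auto simp: bij_betw_def inj_on_def)
  ultimately have "card ?B = m - f x"
    by (metis card_image card_atLeastLessThan)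
  moreover have "{y \<in> A. weakly_prefers (order_of_points A f) y x} = ?B"
    using assms by (auto simp: weakly_prefers_def order_of_points_def)
  ultimately show ?thesis
    by (simp add: rank_def)
qed

lemma points_order_of_points:
  assumes "bij_betw f A {..<card A}" "x \<in> A"
  shows "int (card A) - int (rank A (order_of_points A f) x) = int (f x)"
proof -
  have "f x < card A"
    using assms by (auto simp: bij_betw_def)
  then show ?thesis
    by (simp add: rank_order_of_points[OF assms])
qed

text \<open>If \<open>x\<close> is above \<open>y\<close>, everything above \<open>x\<close> is
  above \<open>y\<close>; equal ranks make the two upper sets equal, so \<open>y\<close> is also
  above \<open>x\<close>. This is what forbids a voter to give \<open>b\<close> and \<open>c\<close>
  the same points.\<close>

lemma rank_inj_on:
  assumes "finite A" "q \<in> linear_orders A"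
  shows "inj_on (rank A q) A"
proof (rule inj_onI)
  have q: "\<And>x y. x \<in> A \<Longrightarrow> y \<in> A \<Longrightarrow> (x, y) \<in> q \<or> (y, x) \<in> q" "trans q" "antisym q"
    using assms(2) by (auto simp: linear_orders_iff)
  have *: "x = y" if "x \<in> A" "y \<in> A" "(x, y) \<in> q" "rank A q x = rank A q y" for x y
  proof -
    have "{z \<in> A. (z, x) \<in> q} \<subseteq> {z \<in> A. (z, y) \<in> q}"
      using q(2) that(3) by (auto dest: transD)
    then have "{z \<in> A. (z, x) \<in> q} = {z \<in> A. (z, y) \<in> q}"
      using that(4) assms(1) by (intro card_subset_eq) (auto simp: rank_def weakly_prefers_def)
    then have "(y, x) \<in> q"
      using that(2) q(1) by blast
    with that(3) q(3) show ?thesis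
      by (auto dest: antisymD)
  qed
  show "x = y" if "x \<in> A" "y \<in> A" "rank A q x = rank A q y" for x y
    using q(1)[OF that(1,2)] *[of x y] *[of y x] that by auto
qed

section \<open>Borda winners, scores after replacing one order, and a criterion for
  manipulability\<close>

lemma borda_eq:
  "borda A I p = {x \<in> A. \<forall>y\<in>A. borda_score A I p y \<le> borda_score A I p x}"
  by (auto simp: borda_def is_arg_max_linorder)

lemma borda_score_fun_upd:
  assumes "finite I" "i \<in> I"
  shows "borda_score A I (p(i := q)) x =
    borda_score A (I - {i}) p x + (int (card A) - int (rank A q x))"
proof -
  have "(\<Sum>j\<in>I - {i}. int (card A) - int (rank A ((p(i := q)) j) x)) = borda_score A (I - {i}) p x"
    unfolding borda_score_def by (intro sum.cong) auto
  then show ?thesis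
    using assms by (simp add: borda_score_def sum.remove[of I i])
qed

lemma winner_infoI:
  assumes "i \<in> I" "q \<in> linear_orders A" "p \<in> profiles A (I - {i})" "F (p(i := q)) = X"
  shows "{p' \<in> profiles A (I - {i}). F (p'(i := q)) = X} \<in> winner_info A I F i q"
  using assms profile_extend[OF assms(1,3,2)] unfolding winner_info_def by blast

text \<open>One profile \<open>p\<close> determines the whole witness: the information set is the
  class of all \<open>p'\<close> that give the same winners as \<open>p\<close> under the sincere
  order \<open>q\<close>, and \<open>p\<close> itself shows the strict gain.\<close>

lemma manipulableI:
  assumes "i \<in> I" "q \<in> linear_orders A" "q' \<in> linear_orders A" "p \<in> profiles A (I - {i})"
    and "strictly_prefers (E q) (F (p(i := q'))) (F (p(i := q)))"
    and "\<And>p'. p' \<in> profiles A (I - {i}) \<Longrightarrow> F (p'(i := q)) = F (p(i := q)) \<Longrightarrow>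
      weakly_prefers (E q) (F (p'(i := q'))) (F (p'(i := q)))"
  shows "manipulable A I (winner_info A I F) E F"
  unfolding manipulable_def
  using assms(1-5) assms(6) winner_infoI[where F = F, OF assms(1,2,4) refl]
  by (intro bexI[of _ i] bexI[of _ q] bexI[of _ q']
      bexI[of _ "{p' \<in> profiles A (I - {i}). F (p'(i := q)) = F (p(i := q))}"]) auto

section \<open>Permutations of the point values\<close>

lemma bij_betw_lessThanI:
  fixes f :: "nat \<Rightarrow> nat"
  assumes "\<And>t. t < m \<Longrightarrow> f t < m"
    and "\<And>s t. s < m \<Longrightarrow> t < m \<Longrightarrow> f s = f t \<Longrightarrow> s = t"
  shows "bij_betw f {..<m} {..<m}"
proof -
  have "inj_on f {..<m}" "f ` {..<m} \<subseteq> {..<m}"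
    using assms by (auto simp: inj_on_def)
  then show ?thesis
    by (simp add: bij_betw_def endo_inj_surj)
qed

lemma bij_betw_lessThan_reverse: "bij_betw (\<lambda>t. m - 1 - t) {..<m} {..<m::nat}"
  by (intro bij_betw_lessThanI) auto

subsection \<open>Two individuals\<close>

lemma borda_manipulable_two:
  fixes A :: "'a set" and I :: "'i set"
  assumes A: "finite A" "card A \<ge> 3" and I: "card I = 2"
  shows "manipulable A I (winner_info A I (borda A I)) (kelly A) (borda A I)"
proof -
  define m where "m = card A"
  have m: "m \<ge> 3"
    using A by (simp add: m_def)
  obtain i j where ij: "I = {i, j}" "i \<noteq> j"
    using I by (auto simp: card_2_iff)
  obtain e where e: "bij_betw e A {..<m}"
    using ex_bij_betw_finite_nat[OF A(1)] by (auto simp: m_def atLeast0LessThan)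
  then have e_inj: "\<And>x y. x \<in> A \<Longrightarrow> y \<in> A \<Longrightarrow> e x = e y \<Longrightarrow> x = y"
    and e_less: "\<And>x. x \<in> A \<Longrightarrow> e x < m"
    by (auto simp: bij_betw_def inj_on_def)
  have "\<exists>x\<in>A. e x = t" if "t < m" for t
    using e that by (metis bij_betw_def imageE lessThan_iff)
  then obtain a b c where abc: "a \<in> A" "b \<in> A" "c \<in> A" "e a = m - 1" "e b = m - 2" "e c = m - 3"
    using m by (metis diff_less less_le_trans zero_less_numeral zero_less_one)
  have ab: "a \<noteq> b"
    using abc m by auto
  define q where "q = order_of_points A e"
  define q' where "q' = order_of_points A (transpose (m - 2) (m - 3) \<circ> e)"
  \<comment> \<open>The other individual exchanges the top two alternatives of \<open>q\<close>, so
    \<open>a\<close> and \<open>b\<close> both total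
    \<open>(m - 1) + (m - 2) = 2 * m - 3\<close>.\<close>
  define r where "r = order_of_points A (transpose (m - 1) (m - 2) \<circ> e)"
  have bij': "bij_betw (transpose (m - 2) (m - 3) \<circ> e) A {..<m}"
    and bijr: "bij_betw (transpose (m - 1) (m - 2) \<circ> e) A {..<m}"
    using m by (auto intro!: bij_betw_trans[OF e] bij_betw_transpose_iff)
  have lin: "q \<in> linear_orders A" "q' \<in> linear_orders A" "r \<in> linear_orders A"
    unfolding q_def q'_def r_def using e bij' bijr
    by (auto intro!: order_of_points_linear simp: bij_betw_def)
  have Iij: "I - {i} = {j}"
    using ij by auto
  have score: "borda_score A I (p(i := o')) x =
      (int m - int (rank A (p j) x)) + (int m - int (rank A o' x))" for p o' x
    using ij Iij by (simp add: borda_score_fun_upd) (simp add: borda_score_def m_def)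
  have scq: "borda_score A I (p(i := q)) x = (int m - int (rank A (p j) x)) + int (e x)"
    if "x \<in> A" for p x
    using points_order_of_points[of e A x] e that by (simp add: score q_def m_def)
  have scq': "borda_score A I (p(i := q')) x =
      (int m - int (rank A (p j) x)) + int (transpose (m - 2) (m - 3) (e x))"
    if "x \<in> A" for p x
    using points_order_of_points[of "transpose (m - 2) (m - 3) \<circ> e" A x] bij' that
    by (simp add: score q'_def m_def)
  \<comment> \<open>The result of misreporting is the same at every profile of the information set,
    which settles the strict and the weak requirement together.\<close>
  have manip: "borda A I (p(i := q')) = {a}"
    if p: "p \<in> profiles A (I - {i})" and win: "borda A I (p(i := q)) = {a, b}" for p
  proof -
    define s where "s x = int m - int (rank A (p j) x)" for x
    have "p j \<in> linear_orders A"
      using p by (auto simp: profiles_def Iij)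
    then have inj: "s x = s y \<Longrightarrow> x = y" if "x \<in> A" "y \<in> A" for x y
      using rank_inj_on[OF A(1)] that by (auto simp: s_def inj_on_def)
    have le: "s y + int (e y) \<le> s x + int (e x)" if "x \<in> {a, b}" "y \<in> A" for x y
      using that abc unfolding win[symmetric] borda_eq by (auto simp: scq s_def)
    have less: "s y + int (e y) < s a + int (e a)" if "y \<in> A" "y \<notin> {a, b}" for y
    proof (rule ccontr)
      assume "\<not> ?thesis"
      then have "y \<in> borda A I (p(i := q))"
        using that abc le[of a] unfolding borda_eq by (fastforce simp: scq s_def)
      with that win show False
        by simp
    qed
    \<comment> \<open>\<open>a\<close> and \<open>b\<close> tie although the manipulator gives
      \<open>a\<close> one point more, so the other individual gives \<open>b\<close> one point
      more.\<close>
    have eq: "s b = s a + 1"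
      using le[of a b] le[of b a] abc m by (auto simp: of_nat_diff)
    have "s y + int (transpose (m - 2) (m - 3) (e y)) < s a + int (m - 1)"
      if y: "y \<in> A" "y \<noteq> a" for y
    proof (cases "y = b \<or> y = c")
      case True
      have c: "c \<noteq> b" "c \<notin> {a, b}"
        using abc m by auto
      \<comment> \<open>Since \<open>c\<close> lost under \<open>q\<close>,
        \<open>s c \<le> s a + 1 = s b\<close>; distinctness of points sharpens this to
        \<open>s c \<le> s a\<close>, so the extra point that \<open>q'\<close> gives to
        \<open>c\<close> does not let it reach \<open>a\<close>.\<close>
      have "s c \<noteq> s b"
        using inj[of b c] c abc by auto
      moreover have "s c + int (m - 3) < s a + int (m - 1)"
        using less[of c] c abc by simp
      ultimately have "s c + int (m - 2) < s a + int (m - 1)"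
        using eq m by linarith
      moreover have "s b + int (m - 3) < s a + int (m - 1)"
        using eq m by linarith
      ultimately show ?thesis
        using True abc by auto
    next
      case False
      then have "e y \<noteq> m - 2" "e y \<noteq> m - 3"
        using abc e_inj[of y b] e_inj[of y c] y by auto
      then show ?thesis
        using less[of y] y False abc by (simp add: transpose_def)
    qed
    moreover have "transpose (m - 2) (m - 3) (e a) = m - 1"
      using abc m by (auto simp: transpose_def)
    ultimately show ?thesis
      unfolding borda_eq using abc by (fastforce simp: scq' s_def)
  qed
  define p where "p = (\<lambda>k\<in>I - {i}. r)"
  have p: "p \<in> profiles A (I - {i})"
    using lin by (auto simp: p_def profiles_def)
  have "p j = r"
    using Iij by (simp add: p_def)
  then have scp: "borda_score A I (p(i := q)) x =
      int (transpose (m - 1) (m - 2) (e x)) + int (e x)" if "x \<in> A" for x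
    using points_order_of_points[of "transpose (m - 1) (m - 2) \<circ> e" A x] bijr that
    by (simp add: scq r_def m_def)
  have scab: "borda_score A I (p(i := q)) x = 2 * int m - 3" if "x \<in> {a, b}" for x
    using that abc m by (auto simp: scp of_nat_diff transpose_def)
  \<comment> \<open>Outside \<open>a\<close> and \<open>b\<close> the orders \<open>q\<close> and
    \<open>r\<close> award the same points, at most \<open>m - 3\<close> each.\<close>
  have scother: "borda_score A I (p(i := q)) x < 2 * int m - 3" if "x \<in> A" "x \<notin> {a, b}" for x
  proof -
    have "e x \<noteq> m - 1" "e x \<noteq> m - 2"
      using that abc e_inj[of x a] e_inj[of x b] by auto
    then show ?thesis
      using that e_less[of x] by (simp add: scp transpose_def)
  qed
  have "borda_score A I (p(i := q)) x \<le> 2 * int m - 3" if "x \<in> A" for x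
    using scab[of x] scother[of x] that by fastforce
  then have win: "borda A I (p(i := q)) = {a, b}"
    unfolding borda_eq using scab scother abc by (fastforce simp del: fun_upd_apply)
  have pref: "(a, b) \<in> q" "(a, a) \<in> q" "(b, a) \<notin> q"
    using abc m by (auto simp: q_def order_of_points_def)
  have K: "({a}, {a, b}) \<in> kelly A q" "({a, b}, {a}) \<notin> kelly A q"
    using pref abc ab by (auto simp: kelly_def nonempty_subsets_def weakly_prefers_def)
  show ?thesis
  proof (rule manipulableI[of i I q A q' p])
    show "i \<in> I"
      using ij by simp
    show "strictly_prefers (kelly A q) (borda A I (p(i := q'))) (borda A I (p(i := q)))"
      using K win manip[OF p win] by (simp add: strictly_prefers_def)
    show "weakly_prefers (kelly A q) (borda A I (p'(i := q'))) (borda A I (p'(i := q)))"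
      if "p' \<in> profiles A (I - {i})" "borda A I (p'(i := q)) = borda A I (p(i := q))" for p'
      using K that win manip[of p'] by (simp add: weakly_prefers_def)
  qed (use lin p in auto)
qed

subsection \<open>At least three individuals\<close>

text \<open>Half of \<open>R\<close> awards \<open>t\<close>, the other half
  \<open>m - 1 - t\<close>; each opposite pair adds \<open>m - 1\<close> for every
  \<open>t\<close>.\<close>

lemma ex_constant_points:
  fixes R :: "'i set" and m :: nat
  assumes "finite R" "even (card R)"
  shows "\<exists>g. (\<forall>j\<in>R. bij_betw (g j) {..<m} {..<m}) \<and> (\<exists>c::nat. \<forall>t<m. (\<Sum>j\<in>R. g j t) = c)"
proof -
  obtain h where h: "card R = 2 * h"
    using assms(2) by (elim evenE)
  obtain J where J: "J \<subseteq> R" "card J = h"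
    using obtain_subset_with_card_n[of h R] h by auto
  define g where "g j t = (if j \<in> J then t else m - 1 - t)" for j and t :: nat
  have "finite J"
    using J(1) assms(1) by (rule finite_subset)
  then have card: "card (R - J) = h"
    using h J by (simp add: card_Diff_subset)
  have "(\<Sum>j\<in>R. g j t) = h * (m - 1)" if "t < m" for t
  proof -
    have "(\<Sum>j\<in>R. g j t) = (\<Sum>j\<in>R - J. g j t) + (\<Sum>j\<in>J. g j t)"
      using J(1) assms(1) by (rule sum.subset_diff)
    also have "\<dots> = h * (m - 1 - t) + h * t"
      using J(2) card by (simp add: g_def)
    also have "\<dots> = h * (m - 1)"
      using that by (simp flip: distrib_left)
    finally show ?thesis .
  qed
  moreover have "bij_betw (g j) {..<m} {..<m}" for j
    using bij_betw_lessThan_reverse[of m] by (cases "j \<in> J") (auto simp: g_def[abs_def] bij_betw_def)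
  ultimately show ?thesis
    by blast
qed

text \<open>The argument \<open>t\<close> stands for the alternative to which the manipulating voter gives \<open>t\<close>
  points; \<open>g j t\<close> is the number of points that \<open>j\<close> gives to it.\<close>

lemma ex_tight_points:
  fixes J :: "'i set" and m :: nat
  assumes J: "finite J" "card J \<ge> 2" and m: "m \<ge> 3"
  shows "\<exists>g. (\<forall>j\<in>J. bij_betw (g j) {..<m} {..<m}) \<and>
    (\<Sum>j\<in>J. g j 0) = (\<Sum>j\<in>J. g j (m - 2)) + (m - 1) \<and>
    (\<forall>t<m. t \<noteq> 0 \<longrightarrow> (\<Sum>j\<in>J. g j t) + t < (\<Sum>j\<in>J. g j 0))"
proof -
  \<comment> \<open>A solution on a small core \<open>C\<close> suffices: the evenly many remaining
    individuals add the same constant to every sum, which preserves the equation and the strict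
    inequalities.\<close>
  have extend: ?thesis
    if C: "C \<subseteq> J" "even (card (J - C))" "\<And>j. j \<in> C \<Longrightarrow> bij_betw (g j) {..<m} {..<m}"
      "(\<Sum>j\<in>C. g j 0) = (\<Sum>j\<in>C. g j (m - 2)) + (m - 1)"
      "\<And>t. t < m \<Longrightarrow> t \<noteq> 0 \<Longrightarrow> (\<Sum>j\<in>C. g j t) + t < (\<Sum>j\<in>C. g j 0)" for C and g :: "'i \<Rightarrow> nat \<Rightarrow> nat"
  proof -
    have "finite (J - C)"
      using J(1) by simp
    from ex_constant_points[OF this C(2), of m]
    obtain g' c where g': "\<And>j. j \<in> J - C \<Longrightarrow> bij_betw (g' j) {..<m} {..<m}"
      "\<And>t. t < m \<Longrightarrow> (\<Sum>j\<in>J - C. g' j t) = (c::nat)"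
      by blast
    define f where "f j = (if j \<in> C then g j else g' j)" for j
    have "(\<Sum>j\<in>J. f j t) = c + (\<Sum>j\<in>C. g j t)" if "t < m" for t
      using g'(2)[OF that] sum.subset_diff[OF C(1) J(1), of "\<lambda>j. f j t"] by (simp add: f_def)
    moreover have "bij_betw (f j) {..<m} {..<m}" if "j \<in> J" for j
      using that C(3) g'(1) by (auto simp: f_def)
    moreover from calculation(1)
    have "(\<Sum>j\<in>J. f j 0) = (\<Sum>j\<in>J. f j (m - 2)) + (m - 1)"
      using C(4) m by simp
    moreover from calculation(1)
    have "(\<Sum>j\<in>J. f j t) + t < (\<Sum>j\<in>J. f j 0)" if "t < m" "t \<noteq> 0" for t
      using C(5)[OF that] that by simp
    ultimately show ?thesis
      by blast
  qed
  show ?thesis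
  proof (cases "even (card J)")
    case True
    obtain C where "C \<subseteq> J" "card C = 2"
      using obtain_subset_with_card_n[OF J(2)] by auto
    then obtain a b where ab: "{a, b} \<subseteq> J" "a \<noteq> b"
      by (auto simp: card_2_iff)
    \<comment> \<open>The sums are \<open>2 * (m - 1)\<close> at \<open>0\<close> and
      \<open>m - 1\<close> at all \<open>t\<close> with \<open>0 < t < m - 1\<close>, in particular
      at \<open>m - 2\<close>; at \<open>m - 1\<close> the sum is \<open>0\<close>.\<close>
    define g where "g j = (if j = a then transpose 0 (m - 1) else (\<lambda>t. m - 1 - t))" for j
    have bij: "bij_betw (g j) {..<m} {..<m}" for j
      using bij_betw_lessThan_reverse[of m] m by (simp add: g_def)
    have sum: "(\<Sum>j\<in>{a, b}. g j t) = transpose 0 (m - 1) t + (m - 1 - t)" for t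
      using ab by (simp add: g_def)
    have sum_0: "(\<Sum>j\<in>{a, b}. g j 0) = 2 * (m - 1)"
      unfolding sum by simp
    show ?thesis
    proof (rule extend[of "{a, b}" g])
      show "even (card (J - {a, b}))"
        using ab True J by (simp add: card_Diff_subset)
      show "(\<Sum>j\<in>{a, b}. g j 0) = (\<Sum>j\<in>{a, b}. g j (m - 2)) + (m - 1)"
        unfolding sum_0 sum using m by simp
      show "(\<Sum>j\<in>{a, b}. g j t) + t < (\<Sum>j\<in>{a, b}. g j 0)" if "t < m" "t \<noteq> 0" for t
        unfolding sum_0 sum using that m by (cases "t = m - 1") auto
    qed (use ab bij in auto)
  next
    case False
    then have "card J \<ge> 3"
      using J(2) by (cases "card J = 2") auto
    then obtain C where "C \<subseteq> J" "card C = 3"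
      using obtain_subset_with_card_n by metis
    then obtain a b c where abc: "{a, b, c} \<subseteq> J" "a \<noteq> b" "a \<noteq> c" "b \<noteq> c"
      by (auto simp: card_3_iff)
    \<comment> \<open>\<open>h\<close> is the cycle sending \<open>0\<close> to
      \<open>m - 2\<close>, \<open>m - 2\<close> to \<open>m - 1\<close> and \<open>m - 1\<close> to
      \<open>0\<close>. With the other two permutations the sums are \<open>3 * m - 4\<close> at
      \<open>0\<close>, \<open>2 * m - 3\<close> at \<open>m - 2\<close>, \<open>1\<close> at
      \<open>m - 1\<close>, and \<open>m - 1 + t\<close> at every other \<open>t\<close>.\<close>
    define h where "h = transpose 0 (m - 2) \<circ> transpose (m - 1) (m - 2)"
    define g where "g j = (if j = a then transpose 0 (m - 1)
      else if j = b then transpose 0 1 \<circ> (\<lambda>t. m - 1 - t) else h)" for j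
    have "bij_betw (transpose 0 1 \<circ> (\<lambda>t. m - 1 - t)) {..<m} {..<m}"
      using m by (intro bij_betw_trans[OF bij_betw_lessThan_reverse] bij_betw_transpose_iff) auto
    moreover have "bij_betw h {..<m} {..<m}"
      unfolding h_def using m by (intro bij_betw_trans[of _ _ "{..<m}"] bij_betw_transpose_iff) auto
    moreover have "bij_betw (transpose 0 (m - 1)) {..<m} {..<m}"
      using m by (intro bij_betw_transpose_iff) auto
    ultimately have bij: "bij_betw (g j) {..<m} {..<m}" for j
      unfolding g_def by presburger
    have sum: "(\<Sum>j\<in>{a, b, c}. g j t) = transpose 0 (m - 1) t + transpose 0 1 (m - 1 - t) + h t" for t
      using abc by (simp add: g_def)
    have sum_0: "(\<Sum>j\<in>{a, b, c}. g j 0) = 3 * m - 4"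
      unfolding sum h_def using m by simp
    show ?thesis
    proof (rule extend[of "{a, b, c}" g])
      show "even (card (J - {a, b, c}))"
        using abc False J \<open>card J \<ge> 3\<close> by (simp add: card_Diff_subset)
      show "(\<Sum>j\<in>{a, b, c}. g j 0) = (\<Sum>j\<in>{a, b, c}. g j (m - 2)) + (m - 1)"
      proof -
        have "m - 1 - (m - 2) = 1"
          using m by simp
        then show ?thesis
          unfolding sum_0 sum h_def using m by simp
      qed
      show "(\<Sum>j\<in>{a, b, c}. g j t) + t < (\<Sum>j\<in>{a, b, c}. g j 0)" if t: "t < m" "t \<noteq> 0" for t
      proof -
        consider "t = m - 1" | "t = m - 2" | "t < m - 2"
          using t by linarith
        then show ?thesis
        proof cases
          case 1
          then show ?thesis
            unfolding sum_0 sum h_def using m by simp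
        next
          case 2
          then have "m - 1 - t = 1"
            using m by simp
          then show ?thesis
            unfolding sum_0 sum h_def using 2 m by simp
        next
          case 3
          then have "m - 1 - t \<noteq> 0" "m - 1 - t \<noteq> 1" "h t = t"
            using t by (auto simp: h_def)
          then show ?thesis
            unfolding sum_0 sum using 3 t by simp
        qed
      qed
    qed (use abc bij in auto)
  qed
qed

lemma borda_manipulable_three:
  fixes A :: "'a set" and I :: "'i set"
  assumes A: "finite A" "card A \<ge> 3" and I: "card I \<ge> 3"
  shows "manipulable A I (winner_info A I (borda A I)) (kelly A) (borda A I)"
proof -
  define m where "m = card A"
  have m: "m \<ge> 3"
    using A by (simp add: m_def)
  have finI: "finite I"
    using I by (intro card_ge_0_finite) auto
  obtain i where i: "i \<in> I"
    using I by fastforce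
  have J: "finite (I - {i})" "card (I - {i}) \<ge> 2"
    using finI I i by auto
  obtain g where g: "\<And>j. j \<in> I - {i} \<Longrightarrow> bij_betw (g j) {..<m} {..<m}"
    "(\<Sum>j\<in>I - {i}. g j 0) = (\<Sum>j\<in>I - {i}. g j (m - 2)) + (m - 1)"
    "\<And>t. t < m \<Longrightarrow> t \<noteq> 0 \<Longrightarrow> (\<Sum>j\<in>I - {i}. g j t) + t < (\<Sum>j\<in>I - {i}. g j (0::nat))"
    using ex_tight_points[OF J m] by blast
  obtain e where e: "bij_betw e A {..<m}"
    using ex_bij_betw_finite_nat[OF A(1)] by (auto simp: m_def atLeast0LessThan)
  then have e_inj: "\<And>x y. x \<in> A \<Longrightarrow> y \<in> A \<Longrightarrow> e x = e y \<Longrightarrow> x = y"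
    and e_less: "\<And>x. x \<in> A \<Longrightarrow> e x < m"
    by (auto simp: bij_betw_def inj_on_def)
  have "\<exists>x\<in>A. e x = t" if "t < m" for t
    using e that by (metis bij_betw_def imageE lessThan_iff)
  then obtain b z where bz: "b \<in> A" "z \<in> A" "e b = m - 2" "e z = 0"
    using m by (metis diff_less less_le_trans zero_less_numeral)
  define q where "q = order_of_points A e"
  define q' where "q' = order_of_points A (transpose (m - 1) (m - 2) \<circ> e)"
  define p where "p = (\<lambda>j\<in>I - {i}. order_of_points A (g j \<circ> e))"
  have bij': "bij_betw (transpose (m - 1) (m - 2) \<circ> e) A {..<m}"
    using m by (auto intro!: bij_betw_trans[OF e] bij_betw_transpose_iff)
  have bijg: "bij_betw (g j \<circ> e) A {..<m}" if "j \<in> I - {i}" for j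
    using g(1)[OF that] by (rule bij_betw_trans[OF e])
  have lin: "q \<in> linear_orders A" "q' \<in> linear_orders A"
    unfolding q_def q'_def using e bij' by (auto intro!: order_of_points_linear simp: bij_betw_def)
  have p: "p \<in> profiles A (I - {i})"
    using bijg unfolding p_def profiles_def
    by (intro restrict_PiE_iff[THEN iffD2] ballI order_of_points_linear) (auto simp: bij_betw_def)
  have rest: "borda_score A (I - {i}) p x = int (\<Sum>j\<in>I - {i}. g j (e x))" if "x \<in> A" for x
    unfolding borda_score_def of_nat_sum
  proof (rule sum.cong)
    fix j assume j: "j \<in> I - {i}"
    show "int (card A) - int (rank A (p j) x) = int (g j (e x))"
      using points_order_of_points[of "g j \<circ> e" A x] bijg[OF j] that j
      by (simp add: p_def m_def)
  qed simp
  have scq: "borda_score A I (p(i := q)) x = int ((\<Sum>j\<in>I - {i}. g j (e x)) + e x)" if "x \<in> A" for x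
    using points_order_of_points[of e A x] e that finI i
    by (simp add: borda_score_fun_upd rest q_def m_def)
  have scq': "borda_score A I (p(i := q')) x =
      int ((\<Sum>j\<in>I - {i}. g j (e x)) + transpose (m - 1) (m - 2) (e x))" if "x \<in> A" for x
    using points_order_of_points[of "transpose (m - 1) (m - 2) \<circ> e" A x] bij' that finI i
    by (simp add: borda_score_fun_upd rest q'_def m_def)
  have less: "borda_score A I (p(i := q)) y < borda_score A I (p(i := q)) z"
    if "y \<in> A" "y \<noteq> z" for y
    using g(3)[of "e y"] e_less[of y] e_inj[of y z] that bz
    by (auto simp: scq simp del: of_nat_add of_nat_sum)
  then have win: "borda A I (p(i := q)) = {z}"
    unfolding borda_eq using bz(2) by (fastforce simp del: fun_upd_apply)
  \<comment> \<open>Under \<open>q\<close>, \<open>b\<close> is one point behind \<open>z\<close> by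
    \<open>g(2)\<close>; the exchange raises \<open>b\<close> from \<open>m - 2\<close> to
    \<open>m - 1\<close> points and leaves \<open>z\<close> at \<open>0\<close>, so they
    tie.\<close>
  have "borda_score A I (p(i := q')) b = borda_score A I (p(i := q')) z"
    using bz m g(2) by (simp add: scq' transpose_def del: of_nat_add of_nat_sum)
  then have "z \<in> borda A I (p(i := q')) \<Longrightarrow> b \<in> borda A I (p(i := q'))"
    using bz by (simp add: borda_eq del: fun_upd_apply)
  moreover have bz': "b \<noteq> z"
    using bz m by auto
  ultimately have lose: "borda A I (p(i := q')) \<noteq> {z}"
    by auto
  have nonempty: "borda A I p' \<in> nonempty_subsets A" if "p' \<in> profiles A I" for p'
    using scc_borda[of A I] A(1) bz(1) that by (auto simp: scc_def)
  \<comment> \<open>As \<open>z\<close> is at the bottom of \<open>q\<close>, any outcome is weakly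
    Kelly-better than \<open>{z}\<close>; hence misreporting is safe at every profile of the
    information set.\<close>
  have worst: "(B, {z}) \<in> kelly A q" if "B \<in> nonempty_subsets A" for B
    using that bz
    by (auto simp: kelly_def nonempty_subsets_def weakly_prefers_def q_def order_of_points_def)
  \<comment> \<open>Only alternatives with \<open>0\<close> points are weakly below
    \<open>z\<close>, and \<open>z\<close> is the only one.\<close>
  have strict: "({z}, B) \<notin> kelly A q" if "B \<in> nonempty_subsets A" "B \<noteq> {z}" for B
  proof
    assume "({z}, B) \<in> kelly A q"
    then have "e y = 0" if "y \<in> B" for y
      using that \<open>B \<noteq> {z}\<close> bz
      by (auto simp: kelly_def weakly_prefers_def q_def order_of_points_def)
    moreover have "B \<subseteq> A"
      using that(1) by (simp add: nonempty_subsets_def)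
    ultimately have "B \<subseteq> {z}"
      using e_inj[OF _ bz(2)] bz(4) by (metis insertI1 subsetD subsetI)
    with that show False
      by (auto simp: nonempty_subsets_def)
  qed
  show ?thesis
  proof (rule manipulableI[of i I q A q' p])
    show "strictly_prefers (kelly A q) (borda A I (p(i := q'))) (borda A I (p(i := q)))"
      using nonempty[OF profile_extend[OF i p lin(2)]] worst strict lose win
      by (simp add: strictly_prefers_def)
    show "weakly_prefers (kelly A q) (borda A I (p'(i := q'))) (borda A I (p'(i := q)))"
      if "p' \<in> profiles A (I - {i})" "borda A I (p'(i := q)) = borda A I (p(i := q))" for p'
      using nonempty[OF profile_extend[OF i that(1) lin(2)]] worst that win
      by (simp add: weakly_prefers_def)
  qed (use i lin p in auto)
qed

theorem theorem16:
  fixes A :: "'a set" and I :: "'i set"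
  assumes "finite A" and "finite I"
    and "card I \<ge> 2"
    and "card A \<ge> 3"
  shows "manipulable A I (winner_info A I (borda A I)) (kelly A) (borda A I)"
proof (cases "card I = 2")
  case True
  with assms show ?thesis
    by (intro borda_manipulable_two)
next
  case False
  with assms show ?thesis
    by (intro borda_manipulable_three) auto
qed

end
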